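(* Let $H$ be a nonzero finite-dimensional Hilbert space of dimension $d$, let $n$ be a natural number, and let $U:W_R;H\Rightarrow W_R;H$ be a (vertically) unitary controlled operation in $\mathbf{2Hilb}$, indexed by $\mathbf{Hilb}^n$. Then $U$ forms part of a solution to the teleportation specification if and only if $U$ is horizontally unitary up to a scalar factor.
   Context: $\mathbf{2Hilb}$ is the 2-category of finite-dimensional 2-Hilbert spaces in matrix form: objects are $\mathbf{Hilb}^n$, $n\in\mathbb{N}$; a 1-cell $\mathbf{Hilb}^n\to\mathbf{Hilb}^m$ is an $m\times n$ matrix of finite-dimensional Hilbert spaces, composed by matrix multiplication with $\oplus$ and $\otimes$; a 2-cell $F\Rightarrow G$ is a matrix of linear maps $F_{i,j}\to G_{i,j}$; vertical composition $\cdot$ is entrywise and horizontal composition is induced by $\oplus$ and $\otimes$; $\dagger$ takes entrywise adjoints, and a 2-cell is (vertically) unitary if it is inverse to its $\dagger$. $I=\mathbf{Hilb}$ is the monoidal unit; a 1-cell $I\to I$ is a Hilbert space. $X;Y$ denotes "first $X$, then $Y$" for 1-cells, and the corresponding horizontal composite for 2-cells; coherence isomorphisms are suppressed. The canonical witness of $\mathbf{Hilb}^n$: $W_L:\mathbf{Hilb}\to\mathbf{Hilb}^n$ and $W_R:\mathbf{Hilb}^n\to\mathbf{Hilb}$ are the column and row matrices with $n$ entries $\mathbb{C}$; $\mathrm{Create}:\mathrm{id}_I\Rightarrow W_L;W_R$ is the linear map $\mathbb{C}\to\mathbb{C}^n$, $1\mapsto(1,\ldots,1)$, and $\mathrm{Delete}=\mathrm{Create}^\dagger$.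 A controlled operation is a 2-cell $U:W_R;H\Rightarrow W_R;H$, i.e. an $n$-tuple $(U_1,\ldots,U_n)$ of linear maps $H\to H$. Fix an orthonormal basis $|1\rangle,\ldots,|d\rangle$ of $H$, let $\mathrm{cup}:\mathrm{id}_I\Rightarrow H;H$ be the linear map $\mathbb{C}\to H\otimes H$, $1\mapsto\sum_{j=1}^d|j\rangle\otimes|j\rangle$, and let $\psi=\frac{1}{\sqrt d}\,\mathrm{cup}$ be the (normalized) Bell state. Teleportation specification: $U$ forms part of a solution if there is a unitary 2-cell $M:H;H\Rightarrow W_L;W_R$ (a nondegenerate measurement on $H\otimes H$) such that, as 2-cells $H\Rightarrow W_L;W_R;H$, $$(\mathrm{id}_{W_L};U)\cdot(M;\mathrm{id}_H)\cdot(\mathrm{id}_H;\psi)=\frac{1}{\sqrt n}\,(\mathrm{Create};\mathrm{id}_H).$$ Horizontal unitarity: $U$ is horizontally unitary if the 2-cell obtained by bending its upper-left and lower-right wires, $$\widetilde U=(\mathrm{Delete};\mathrm{id}_{H;H})\cdot(\mathrm{id}_{W_L};U;\mathrm{id}_H)\cdot(\mathrm{id}_{W_L;W_R};\mathrm{cup}):\ W_L;W_R\Rightarrow H;H,$$ is unitary. $U$ is horizontally unitary up to a scalar factor if $\lambda U$ is horizontally unitary for some nonzero $\lambda\in\mathbb{C}$. *)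

theory Defs
  imports
    "Jordan_Normal_Form.Matrix"
    "Jordan_Normal_Form.Schur_Decomposition"
begin

section \<open>The 2-category 2Hilb in matrix form\<close>

text \<open>
  We use the skeleton: the object \<open>Hilb\<^sup>n\<close> is the number \<open>n\<close>, and the finite-dimensional
  Hilbert space \<open>\<complex>\<^sup>k\<close> with its standard orthonormal basis is its dimension \<open>k\<close>.
  A 1-cell \<open>Hilb\<^sup>n \<rightarrow> Hilb\<^sup>m\<close> is thus an \<open>m \<times> n\<close> matrix of dimensions, and a 2-cell
  \<open>F \<Rightarrow> G\<close> is a matrix whose \<open>(i,j)\<close> entry is the matrix of a linear map
  \<open>\<complex>\<^bsup>F(i,j)\<^esup> \<rightarrow> \<complex>\<^bsup>G(i,j)\<^esup>\<close>.
\<close>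

type_synonym one_cell = "nat mat"
type_synonym two_cell = "complex mat mat"

definition is_two_cell :: "two_cell \<Rightarrow> one_cell \<Rightarrow> one_cell \<Rightarrow> bool" where
  "is_two_cell \<alpha> F G \<longleftrightarrow>
     dim_row \<alpha> = dim_row F \<and> dim_col \<alpha> = dim_col F \<and>
     dim_row G = dim_row F \<and> dim_col G = dim_col F \<and>
     (\<forall>i<dim_row F. \<forall>j<dim_col F. \<alpha> $$ (i,j) \<in> carrier_mat (G $$ (i,j)) (F $$ (i,j)))"

text \<open>
  \<open>X \<Zsemi>\<^sub>1 Y\<close> is ``first \<open>X\<close>, then \<open>Y\<close>'', i.e. the matrix product \<open>Y X\<close>
  (on dimensions, \<open>\<oplus>\<close> is addition and \<open>\<otimes>\<close> is multiplication).
\<close>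
definition comp1 :: "one_cell \<Rightarrow> one_cell \<Rightarrow> one_cell" (infixl "\<Zsemi>\<^sub>1" 75) where
  "X \<Zsemi>\<^sub>1 Y = Y * X"

definition id_cell :: "one_cell \<Rightarrow> two_cell" where
  "id_cell F = mat (dim_row F) (dim_col F) (\<lambda>(i,j). 1\<^sub>m (F $$ (i,j)))"

text \<open>Vertical composition: \<open>\<beta> \<cdot> \<alpha>\<close> is ``\<open>\<beta>\<close> after \<open>\<alpha>\<close>''.\<close>
definition vcomp :: "two_cell \<Rightarrow> two_cell \<Rightarrow> two_cell" (infixl "\<cdot>" 70) where
  "\<beta> \<cdot> \<alpha> = mat (dim_row \<alpha>) (dim_col \<alpha>) (\<lambda>(i,j). \<beta> $$ (i,j) * \<alpha> $$ (i,j))"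

definition dagger :: "two_cell \<Rightarrow> two_cell" where
  "dagger \<alpha> = mat (dim_row \<alpha>) (dim_col \<alpha>) (\<lambda>(i,j). mat_adjoint (\<alpha> $$ (i,j)))"

definition scale2 :: "complex \<Rightarrow> two_cell \<Rightarrow> two_cell" where
  "scale2 c \<alpha> = mat (dim_row \<alpha>) (dim_col \<alpha>) (\<lambda>(i,j). c \<cdot>\<^sub>m \<alpha> $$ (i,j))"

text \<open>
  The tensor product of linear maps, for the basis \<open>|r\<rangle> \<otimes> |s\<rangle>\<close> of \<open>\<complex>\<^sup>m \<otimes> \<complex>\<^sup>k\<close> ordered
  lexicographically, that is, numbered by \<open>r * k + s\<close>.
\<close>
definition kron :: "complex mat \<Rightarrow> complex mat \<Rightarrow> complex mat" where
  "kron A B = mat (dim_row A * dim_row B) (dim_col A * dim_col B)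
     (\<lambda>(r,c). A $$ (r div dim_row B, c div dim_col B) * B $$ (r mod dim_row B, c mod dim_col B))"

text \<open>
  Horizontal composition: \<open>(\<alpha> \<Zsemi>\<^sub>2 \<beta>)(i,k) = \<Oplus>\<^sub>j \<alpha>(j,k) \<otimes> \<beta>(i,j)\<close>.
  The tensor factor of the cell that comes first is written first, as in \<open>X;Y\<close>.
\<close>
definition hcomp :: "two_cell \<Rightarrow> two_cell \<Rightarrow> two_cell" (infixl "\<Zsemi>\<^sub>2" 75) where
  "\<alpha> \<Zsemi>\<^sub>2 \<beta> = mat (dim_row \<beta>) (dim_col \<alpha>)
     (\<lambda>(i,k). diag_block_mat (map (\<lambda>j. kron (\<alpha> $$ (j,k)) (\<beta> $$ (i,j))) [0..<dim_row \<alpha>]))"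

definition unitary_cell :: "two_cell \<Rightarrow> one_cell \<Rightarrow> one_cell \<Rightarrow> bool" where
  "unitary_cell \<alpha> F G \<longleftrightarrow>
     is_two_cell \<alpha> F G \<and> dagger \<alpha> \<cdot> \<alpha> = id_cell F \<and> \<alpha> \<cdot> dagger \<alpha> = id_cell G"


section \<open>Suppressed coherence isomorphisms\<close>

text \<open>
  With these conventions horizontal composition is strictly associative whenever the second and
  third cell are composed along \<open>Hilb\<close> (lemma \<open>hcomp_assoc\<close>), and \<open>id_I\<close> is a strict unit
  (\<open>kron (1\<^sub>m 1) A = A\<close>). These are the only coherences needed below, in
  \<open>(W\<^sub>L;W\<^sub>R);H = W\<^sub>L;(W\<^sub>R;H)\<close> and its relatives, so that all composites below are
  literally composable and no coherence isomorphism has to be inserted.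
\<close>

lemma kron_dim [simp]:
  "dim_row (kron A B) = dim_row A * dim_row B" "dim_col (kron A B) = dim_col A * dim_col B"
  by (simp_all add: kron_def)

lemma kron_assoc: "kron (kron A B) C = kron A (kron B C)"
proof (rule eq_matI)
  fix r c assume "r < dim_row (kron A (kron B C))" "c < dim_col (kron A (kron B C))"
  then have r: "r < dim_row A * dim_row B * dim_row C" and c: "c < dim_col A * dim_col B * dim_col C"
    by (simp_all add: mult.assoc)
  have aux: "x div k < m * l" if "x < m * l * k" for x k l m :: nat
    using that by (simp add: less_mult_imp_div_less)
  have p: "0 < dim_row B * dim_row C" "0 < dim_col B * dim_col C"
    using r c by (auto intro!: Nat.gr0I)
  have md: "x mod (b * k) div k = x div k mod b" for x b k :: nat
    by (cases "k = 0") (simp_all add: mod_mult2_eq mult.commute[of b k])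
  have mm: "x mod (b * k) mod k = x mod k" for x b k :: nat
    by (simp add: mod_mod_cancel)
  have dd: "x div (b * k) = x div k div b" for x b k :: nat
    by (metis div_mult2_eq mult.commute)
  show "kron (kron A B) C $$ (r, c) = kron A (kron B C) $$ (r, c)"
    using r c aux[OF r] aux[OF c] p
    by (simp add: kron_def md mm dd mult.assoc)
qed (simp_all add: mult.assoc)

lemma kron_unit_left: "kron (1\<^sub>m 1) A = A"
  by (rule eq_matI) (auto simp: kron_def)

lemma kron_unit_right: "kron A (1\<^sub>m 1) = A"
  by (rule eq_matI) (auto simp: kron_def)

lemma kron_four_block:
  "kron (four_block_mat A (0\<^sub>m (dim_row A) (dim_col D)) (0\<^sub>m (dim_row D) (dim_col A)) D) B =
   four_block_mat (kron A B) (0\<^sub>m (dim_row (kron A B)) (dim_col (kron D B)))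
     (0\<^sub>m (dim_row (kron D B)) (dim_col (kron A B))) (kron D B)"
  (is "?L = ?R")
proof (rule eq_matI)
  fix r c assume "r < dim_row ?R" "c < dim_col ?R"
  then have r: "r < (dim_row A + dim_row D) * dim_row B"
    and c: "c < (dim_col A + dim_col D) * dim_col B"
    by (simp_all add: algebra_simps)
  have p: "dim_row B > 0" "dim_col B > 0"
    using r c by (auto intro!: Nat.gr0I)
  have lt: "x div k < m \<longleftrightarrow> x < m * k" if "k > 0" for x k m :: nat
    using that by (simp add: div_less_iff_less_mult)
  have dv: "(x - m * k) div k = x div k - m" "(x - m * k) mod k = x mod k" if "\<not> x < m * k" "k > 0"
    for x k m :: nat
  proof -
    from that obtain y where y: "x = m * k + y"
      by (metis le_Suc_ex not_less)
    show "(x - m * k) div k = x div k - m" "(x - m * k) mod k = x mod k"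
      using that(2) by (simp_all add: y)
  qed
  have ds: "x - m * k < l * k" if "\<not> x < m * k" "x < (m + l) * k" for x m k l :: nat
    using that by (simp add: algebra_simps)
  have "r div dim_row B - dim_row A < dim_row D" if "\<not> r < dim_row A * dim_row B"
    using ds[OF that r] by (simp only: dv(1)[OF that p(1), symmetric] lt[OF p(1)])
  moreover have "c div dim_col B - dim_col A < dim_col D" if "\<not> c < dim_col A * dim_col B"
    using ds[OF that c] by (simp only: dv(1)[OF that p(2), symmetric] lt[OF p(2)])
  ultimately show "?L $$ (r, c) = ?R $$ (r, c)"
    using r c p ds[OF _ r] ds[OF _ c]
    by (auto simp: kron_def lt dv algebra_simps)
qed (simp_all add: algebra_simps)

lemma kron_diag_block_mat:
  "kron (diag_block_mat As) B = diag_block_mat (map (\<lambda>A. kron A B) As)"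
proof (induction As)
  case Nil
  show ?case by (rule eq_matI) (simp_all add: kron_def)
next
  case (Cons A As)
  then show ?case
    by (simp add: Let_def kron_four_block)
qed

lemma hcomp_assoc:
  assumes "dim_row \<alpha> = dim_col \<beta>" "dim_row \<beta> = 1" "dim_col \<gamma> = 1"
  shows "(\<alpha> \<Zsemi>\<^sub>2 \<beta>) \<Zsemi>\<^sub>2 \<gamma> = \<alpha> \<Zsemi>\<^sub>2 (\<beta> \<Zsemi>\<^sub>2 \<gamma>)"
proof (rule eq_matI)
  have b: "(\<beta> \<Zsemi>\<^sub>2 \<gamma>) $$ (i,l) = kron (\<beta> $$ (0,l)) (\<gamma> $$ (i,0))"
    if "i < dim_row \<gamma>" "l < dim_row \<alpha>" for i l
    using that assms by (simp add: hcomp_def del: diag_block_mat.simps)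
  fix i k assume "i < dim_row (\<alpha> \<Zsemi>\<^sub>2 (\<beta> \<Zsemi>\<^sub>2 \<gamma>))" "k < dim_col (\<alpha> \<Zsemi>\<^sub>2 (\<beta> \<Zsemi>\<^sub>2 \<gamma>))"
  then have i: "i < dim_row \<gamma>" and k: "k < dim_col \<alpha>"
    by (simp_all add: hcomp_def)
  have "((\<alpha> \<Zsemi>\<^sub>2 \<beta>) \<Zsemi>\<^sub>2 \<gamma>) $$ (i,k) = kron ((\<alpha> \<Zsemi>\<^sub>2 \<beta>) $$ (0,k)) (\<gamma> $$ (i,0))"
    using i k assms by (simp add: hcomp_def del: diag_block_mat.simps)
  also have "\<dots> = diag_block_mat
      (map (\<lambda>l. kron (\<alpha> $$ (l,k)) (kron (\<beta> $$ (0,l)) (\<gamma> $$ (i,0)))) [0..<dim_row \<alpha>])"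
    using k assms by (simp add: hcomp_def kron_diag_block_mat kron_assoc o_def)
  also have "\<dots> = diag_block_mat
      (map (\<lambda>l. kron (\<alpha> $$ (l,k)) ((\<beta> \<Zsemi>\<^sub>2 \<gamma>) $$ (i,l))) [0..<dim_row \<alpha>])"
    using b[OF i] by (intro arg_cong[where f = diag_block_mat] map_cong) auto
  also have "\<dots> = (\<alpha> \<Zsemi>\<^sub>2 (\<beta> \<Zsemi>\<^sub>2 \<gamma>)) $$ (i,k)"
    using i k by (simp add: hcomp_def[of \<alpha>] hcomp_def[of \<beta> \<gamma>, THEN arg_cong[of _ _ dim_row]])
  finally show "((\<alpha> \<Zsemi>\<^sub>2 \<beta>) \<Zsemi>\<^sub>2 \<gamma>) $$ (i,k) = (\<alpha> \<Zsemi>\<^sub>2 (\<beta> \<Zsemi>\<^sub>2 \<gamma>)) $$ (i,k)" .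
qed (simp_all add: hcomp_def)

lemma hcomp_two_cell:
  assumes \<alpha>: "is_two_cell \<alpha> F G" and \<beta>: "is_two_cell \<beta> F' G'" and d: "dim_row F = dim_col F'"
  shows "is_two_cell (\<alpha> \<Zsemi>\<^sub>2 \<beta>) (F \<Zsemi>\<^sub>1 F') (G \<Zsemi>\<^sub>1 G')"
proof -
  note [simp del] = diag_block_mat.simps
  have sz: "dim_row \<alpha> = dim_row F" "dim_col \<alpha> = dim_col F" "dim_row G = dim_row F"
    "dim_col G = dim_col F" "dim_row \<beta> = dim_row F'" "dim_col \<beta> = dim_col F'"
    "dim_row G' = dim_row F'" "dim_col G' = dim_col F'"
    using \<alpha> \<beta> by (simp_all add: is_two_cell_def)
  have "(\<alpha> \<Zsemi>\<^sub>2 \<beta>) $$ (i,k) \<in> carrier_mat ((G \<Zsemi>\<^sub>1 G') $$ (i,k)) ((F \<Zsemi>\<^sub>1 F') $$ (i,k))"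
    if i: "i < dim_row F'" and k: "k < dim_col F" for i k
  proof -
    have A: "\<alpha> $$ (j,k) \<in> carrier_mat (G $$ (j,k)) (F $$ (j,k))" if "j < dim_row F" for j
      using \<alpha> k that by (simp add: is_two_cell_def)
    have B: "\<beta> $$ (i,j) \<in> carrier_mat (G' $$ (i,j)) (F' $$ (i,j))" if "j < dim_row F" for j
      using \<beta> i d that by (simp add: is_two_cell_def)
    have "dim_row (\<alpha> $$ (j,k)) * dim_row (\<beta> $$ (i,j)) = G' $$ (i,j) * G $$ (j,k)"
      "dim_col (\<alpha> $$ (j,k)) * dim_col (\<beta> $$ (i,j)) = F' $$ (i,j) * F $$ (j,k)"
      if "j < dim_row F" for j
      using A[OF that] B[OF that] by (auto simp only: carrier_matD mult.commute)
    then show ?thesis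
      using i k sz d
      by (intro carrier_matI)
        (simp_all add: hcomp_def comp1_def scalar_prod_def dim_diag_block_mat o_def
          interv_sum_list_conv_sum_set_nat)
  qed
  then show ?thesis
    using sz d unfolding is_two_cell_def by (simp add: hcomp_def comp1_def)
qed


section \<open>Witnesses, the Bell state, teleportation and horizontal unitarity\<close>

definition hilb :: "nat \<Rightarrow> one_cell" where
  "hilb d = mat 1 1 (\<lambda>_. d)"

abbreviation id_I :: one_cell where
  "id_I \<equiv> hilb 1"

definition W_L :: "nat \<Rightarrow> one_cell" where
  "W_L n = mat n 1 (\<lambda>_. 1)"

definition W_R :: "nat \<Rightarrow> one_cell" where
  "W_R n = mat 1 n (\<lambda>_. 1)"

definition Create :: "nat \<Rightarrow> two_cell" where
  "Create n = mat 1 1 (\<lambda>_. mat n 1 (\<lambda>_. 1))"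

definition Delete :: "nat \<Rightarrow> two_cell" where
  "Delete n = dagger (Create n)"

definition ket :: "nat \<Rightarrow> nat \<Rightarrow> complex mat" where
  "ket d j = mat d 1 (\<lambda>(r,_). if r = j then 1 else 0)"

definition cup :: "nat \<Rightarrow> two_cell" where
  "cup d = mat 1 1 (\<lambda>_. mat (d * d) 1 (\<lambda>rc. \<Sum>j<d. kron (ket d j) (ket d j) $$ rc))"

definition bell :: "nat \<Rightarrow> two_cell" where
  "bell d = scale2 (complex_of_real (1 / sqrt (real d))) (cup d)"

definition teleportation_solution :: "nat \<Rightarrow> nat \<Rightarrow> two_cell \<Rightarrow> bool" where
  "teleportation_solution d n U \<longleftrightarrow>
     (\<exists>M. unitary_cell M (hilb d \<Zsemi>\<^sub>1 hilb d) (W_L n \<Zsemi>\<^sub>1 W_R n) \<and>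
       (id_cell (W_L n) \<Zsemi>\<^sub>2 U) \<cdot> (M \<Zsemi>\<^sub>2 id_cell (hilb d)) \<cdot> (id_cell (hilb d) \<Zsemi>\<^sub>2 bell d)
         = scale2 (complex_of_real (1 / sqrt (real n))) (Create n \<Zsemi>\<^sub>2 id_cell (hilb d)))"

definition bend :: "nat \<Rightarrow> nat \<Rightarrow> two_cell \<Rightarrow> two_cell" where
  "bend d n U =
     (Delete n \<Zsemi>\<^sub>2 id_cell (hilb d \<Zsemi>\<^sub>1 hilb d))
     \<cdot> (id_cell (W_L n) \<Zsemi>\<^sub>2 U \<Zsemi>\<^sub>2 id_cell (hilb d))
     \<cdot> (id_cell (W_L n \<Zsemi>\<^sub>1 W_R n) \<Zsemi>\<^sub>2 cup d)"

definition horizontally_unitary :: "nat \<Rightarrow> nat \<Rightarrow> two_cell \<Rightarrow> bool" where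
  "horizontally_unitary d n U \<longleftrightarrow>
     unitary_cell (bend d n U) (W_L n \<Zsemi>\<^sub>1 W_R n) (hilb d \<Zsemi>\<^sub>1 hilb d)"

definition horizontally_unitary_up_to_scalar :: "nat \<Rightarrow> nat \<Rightarrow> two_cell \<Rightarrow> bool" where
  "horizontally_unitary_up_to_scalar d n U \<longleftrightarrow>
     (\<exists>c. c \<noteq> 0 \<and> horizontally_unitary d n (scale2 c U))"


section \<open>Arbitrary finite-dimensional Hilbert spaces\<close>

text \<open>
  The inner product is conjugate-linear in its first and linear in its second argument.
  Completeness is automatic in finite dimension.
\<close>
locale fd_hilbert = vector_space scale
  for scale :: "complex \<Rightarrow> 'h::ab_group_add \<Rightarrow> 'h" +
  fixes ip :: "'h \<Rightarrow> 'h \<Rightarrow> complex"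
  assumes finite_dim: "\<exists>B. finite B \<and> span B = UNIV"
    and ip_add: "ip x (y + z) = ip x y + ip x z"
    and ip_scale: "ip x (scale c y) = c * ip x y"
    and ip_cnj: "ip y x = cnj (ip x y)"
    and ip_nonneg: "Re (ip x x) \<ge> 0"
    and ip_definite: "ip x x = 0 \<Longrightarrow> x = 0"
begin

definition orthonormal_basis :: "(nat \<Rightarrow> 'h) \<Rightarrow> nat \<Rightarrow> bool" where
  "orthonormal_basis e d \<longleftrightarrow>
     (\<forall>i<d. \<forall>j<d. ip (e i) (e j) = (if i = j then 1 else 0)) \<and> span (e ` {..<d}) = UNIV"

end

text \<open>
  The fixed orthonormal basis \<open>e\<close> of \<open>H\<close> identifies \<open>H\<close> with \<open>\<complex>\<^sup>d\<close>, and so the tuple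
  \<open>(U\<^sub>0, \<dots>, U\<^bsub>n-1\<^esub>)\<close> of linear maps \<open>H \<rightarrow> H\<close> with the 2-cell
  \<open>W\<^sub>R;H \<Rightarrow> W\<^sub>R;H\<close> whose entries are their matrices with respect to \<open>e\<close>.
\<close>
definition controlled :: "('h \<Rightarrow> 'h \<Rightarrow> complex) \<Rightarrow> (nat \<Rightarrow> 'h) \<Rightarrow> nat \<Rightarrow> nat \<Rightarrow> (nat \<Rightarrow> 'h \<Rightarrow> 'h) \<Rightarrow> two_cell" where
  "controlled ip e d n U = mat 1 n (\<lambda>(_,i). mat d d (\<lambda>(r,c). ip (e r) (U i (e c))))"

end

theory Submission
  imports Defs
begin

text \<open>
  Everything is controlled by one matrix. Stack the entries of the unitaries \<open>U\<^sub>i\<close> into the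
  \<open>d\<^sup>2 \<times> n\<close> matrix \<open>B\<close> with \<open>B((r,s),i) = U\<^sub>i(r,s)\<close> (\<open>bend_mat\<close>).

  Bending the wires of \<open>U\<close> produces exactly \<open>B\<close> (\<open>bend_tuple\<close>): the cup turns the input index of
  \<open>U\<^sub>i\<close> into a second output index, and \<open>Delete\<close> adds up the blocks, of which only the
  one selected by the classical index \<open>i\<close> is nonzero.

  In the teleportation composite the Bell state transports the second input index of \<open>M\<close> to an output,
  so that block \<open>i\<close> of the equation reads \<open>U\<^sub>i N\<^sub>i = \<surd>(d/n) 1\<close>, where \<open>N\<^sub>i(s,a) = M(i,(a,s))\<close>.
  As \<open>U\<^sub>i\<close> is unitary, this has precisely one solution, \<open>N\<^sub>i = \<surd>(d/n) U\<^sub>i\<^sup>\<dagger>\<close>, and collecting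
  the blocks gives \<open>M = \<surd>(d/n) B\<^sup>\<dagger>\<close> (\<open>teleportation_equation_iff\<close>). A measurement that solves the
  specification therefore exists if and only if \<open>\<surd>(d/n) B\<close> is unitary.

  It remains to see that \<open>\<surd>(d/n)\<close> is, up to a phase, the only scalar \<open>c\<close> for which \<open>c B\<close> can be unitary.
  This is a count of squared entries. A unitary map is square, so \<open>n = d\<^sup>2\<close>,
  and its squared entries sum to its size; those of \<open>B\<close> sum to \<open>n d\<close>, because each \<open>U\<^sub>i\<close>
  contributes \<open>d\<close>. Hence \<open>\<bar>c\<bar>\<^sup>2 n d = n\<close>, that is \<open>\<bar>c\<bar>\<^sup>2 = 1/d = d/n\<close> (\<open>bend_mat_scalar\<close>).
\<close>

section \<open>Block indices\<close>

lemma block_index_less: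
  fixes i r m k :: nat
  assumes "i < m" "r < k"
  shows "i * k + r < m * k"
proof -
  have "i * k + r < Suc i * k" using assms(2) by simp
  also have "\<dots> \<le> m * k" using assms(1) by (intro mult_le_mono1) simp
  finally show ?thesis .
qed

lemma less_mult_blockE:
  fixes x m k :: nat
  assumes "x < m * k"
  obtains i r where "i < m" "r < k" "x = i * k + r"
proof
  have "k > 0" using assms by (auto intro!: Nat.gr0I)
  then show "x mod k < k" by simp
  show "x div k < m" using assms by (simp add: less_mult_imp_div_less)
  show "x = x div k * k + x mod k" by simp
qed

lemma sum_block:
  fixes f :: "nat \<Rightarrow> 'a::comm_monoid_add"
  shows "(\<Sum>x<m * k. f x) = (\<Sum>i<m. \<Sum>r<k. f (i * k + r))"
proof -
  have "(\<Sum>r<k. f (i * k + r)) = sum f {i * k..<i * k + k}" for i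
    using sum.shift_bounds_nat_ivl[of f 0 "i * k" k]
    by (simp add: atLeast0LessThan add.commute)
  then show ?thesis by (simp add: sum.nat_group)
qed

text \<open>
  Matrix products of identities, cups and block matrices become nested sums of Kronecker deltas; this
  moves a delta out of the inner sums that do not bind its index.
\<close>
lemma sum_if_const:
  "(\<Sum>x\<in>A. if P then f x else 0) = (if P then \<Sum>x\<in>A. f x else (0 :: 'a::comm_monoid_add))"
  by simp

text \<open>
  All the composites below act on tensor products, whose basis vectors are numbered \<open>i * k + r\<close>;
  this lets them be compared one pair of tensor indices at a time.
\<close>
lemma mat_eq_block_iff:
  assumes "A \<in> carrier_mat (m * k) q" "B \<in> carrier_mat (m * k) q"
  shows "A = B \<longleftrightarrow> (\<forall>i<m. \<forall>r<k. \<forall>c<q. A $$ (i * k + r, c) = B $$ (i * k + r, c))"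
proof (intro iffI)
  assume R: "\<forall>i<m. \<forall>r<k. \<forall>c<q. A $$ (i * k + r, c) = B $$ (i * k + r, c)"
  show "A = B"
  proof (rule eq_matI)
    fix x c assume "x < dim_row B" "c < dim_col B"
    then have "x < m * k" "c < q" using assms by auto
    then show "A $$ (x, c) = B $$ (x, c)" using R by (metis less_mult_blockE)
  qed (use assms in auto)
qed simp

lemma mat_mult_index_sum:
  assumes "A \<in> carrier_mat p q" "B \<in> carrier_mat q s" "r < p" "c < s"
  shows "(A * B) $$ (r, c) = (\<Sum>x<q. A $$ (r, x) * B $$ (x, c))"
  using assms by (simp add: scalar_prod_def atLeast0LessThan)

lemma kron_carrier:
  assumes "A \<in> carrier_mat p q" "B \<in> carrier_mat p' q'"
  shows "kron A B \<in> carrier_mat (p * p') (q * q')"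
  using assms by (auto intro!: carrier_matI)

lemma kron_index:
  assumes "A \<in> carrier_mat p q" "B \<in> carrier_mat p' q'"
    and "i < p" "r < p'" "j < q" "s < q'"
  shows "kron A B $$ (i * p' + r, j * q' + s) = A $$ (i, j) * B $$ (r, s)"
  using assms block_index_less[of i p r p'] block_index_less[of j q s q']
  by (simp add: kron_def)

lemma diag_block_mat_carrier:
  assumes "\<forall>A\<in>set As. A \<in> carrier_mat p q"
  shows "diag_block_mat As \<in> carrier_mat (length As * p) (length As * q)"
proof (rule carrier_matI)
  have "map dim_row As = map (\<lambda>_. p) As" "map dim_col As = map (\<lambda>_. q) As"
    using assms by auto
  then show "dim_row (diag_block_mat As) = length As * p"
    "dim_col (diag_block_mat As) = length As * q"
    by (simp_all only: dim_diag_block_mat sum_list_triv of_nat_id)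
qed

lemma diag_block_mat_index:
  assumes "\<forall>A\<in>set As. A \<in> carrier_mat p q"
    and "i < length As" "j < length As" "r < p" "s < q"
  shows "diag_block_mat As $$ (i * p + r, j * q + s) = (if i = j then (As ! i) $$ (r, s) else 0)"
  using assms(1-3)
proof (induction As arbitrary: i j)
  case Nil
  then show ?case by simp
next
  case (Cons A As)
  let ?D = "diag_block_mat As"
  have A: "dim_row A = p" "dim_col A = q" using Cons.prems by auto
  have D: "dim_row ?D = length As * p" "dim_col ?D = length As * q"
    using diag_block_mat_carrier[of As p q] Cons.prems by auto
  have lt: "i * p + r < p + length As * p" "j * q + s < q + length As * q"
    using block_index_less[of i "Suc (length As)" r p] block_index_less[of j "Suc (length As)" s q]
      Cons.prems assms(4,5) by simp_all
  have IH: "?D $$ (i' * p + r, j' * q + s) = (if i' = j' then (As ! i') $$ (r, s) else 0)"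
    if "i' < length As" "j' < length As" for i' j'
    using Cons.IH[of i' j'] Cons.prems that by simp
  show ?case
  proof (cases i; cases j)
    fix i' j' assume ij: "i = Suc i'" "j = Suc j'"
    then show ?thesis using lt A D IH[of i' j'] Cons.prems by (simp add: Let_def)
  qed (use lt A D assms(4,5) Cons.prems block_index_less[of "i - 1" "length As" r p]
        block_index_less[of "j - 1" "length As" s q] in \<open>simp_all add: Let_def\<close>)
qed

section \<open>Adjoints and unitary matrices\<close>

lemma mat_adjoint_carrier:
  assumes "A \<in> carrier_mat p q"
  shows "mat_adjoint A \<in> carrier_mat q p"
  using assms by (auto simp: mat_adjoint_def intro!: carrier_matI)

lemma mat_adjoint_dim [simp]:
  "dim_row (mat_adjoint A) = dim_col A" "dim_col (mat_adjoint A) = dim_row A"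
  by (simp_all add: mat_adjoint_def)

lemma mat_adjoint_index [simp]:
  fixes A :: "complex mat"
  assumes "i < dim_col A" "j < dim_row A"
  shows "mat_adjoint A $$ (i, j) = cnj (A $$ (j, i))"
  using assms by (simp add: mat_adjoint_def mat_of_rows_index conjugate_vec_def)

lemma mat_adjoint_adjoint [simp]:
  fixes A :: "complex mat"
  shows "mat_adjoint (mat_adjoint A) = A"
  by (rule eq_matI) simp_all

lemma mat_adjoint_smult:
  fixes A :: "complex mat"
  shows "mat_adjoint (c \<cdot>\<^sub>m A) = cnj c \<cdot>\<^sub>m mat_adjoint A"
  by (rule eq_matI) simp_all

text \<open>
  This is unitarity of a linear map \<open>\<complex>\<^sup>p \<rightarrow> \<complex>\<^sup>q\<close> between possibly different spaces, with
  both one-sided conditions as in the notion for 2-cells, so that \<open>p = q\<close> is a consequence.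
\<close>
definition unitary_map :: "complex mat \<Rightarrow> nat \<Rightarrow> nat \<Rightarrow> bool" where
  "unitary_map A p q \<longleftrightarrow>
     A \<in> carrier_mat q p \<and> mat_adjoint A * A = 1\<^sub>m p \<and> A * mat_adjoint A = 1\<^sub>m q"

lemma unitary_map_adjoint:
  "unitary_map A p q \<Longrightarrow> unitary_map (mat_adjoint A) q p"
  by (auto simp: unitary_map_def mat_adjoint_carrier)

text \<open>
  The scalar enters only through its modulus. This allows an arbitrary scalar to be replaced by
  the real one that the teleportation equation prescribes.
\<close>
lemma unitary_map_smult_iff:
  assumes "B \<in> carrier_mat q p"
  shows "unitary_map (c \<cdot>\<^sub>m B) p q \<longleftrightarrow>
    complex_of_real ((cmod c)\<^sup>2) \<cdot>\<^sub>m (mat_adjoint B * B) = 1\<^sub>m p \<and>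
    complex_of_real ((cmod c)\<^sup>2) \<cdot>\<^sub>m (B * mat_adjoint B) = 1\<^sub>m q"
proof -
  have B: "B \<in> carrier_mat q p" "mat_adjoint B \<in> carrier_mat p q"
    using assms mat_adjoint_carrier by auto
  define k where "k = complex_of_real ((cmod c)\<^sup>2)"
  have cc: "c * cnj c = k" "cnj c * c = k"
    unfolding k_def by (metis complex_norm_square, metis complex_norm_square mult.commute)
  have ss: "a \<cdot>\<^sub>m (b \<cdot>\<^sub>m X) = (a * b) \<cdot>\<^sub>m X" for a b and X :: "complex mat"
    by (rule eq_matI) simp_all
  have 1: "mat_adjoint (c \<cdot>\<^sub>m B) * (c \<cdot>\<^sub>m B) = k \<cdot>\<^sub>m (mat_adjoint B * B)"
    using B by (simp add: mat_adjoint_smult mult_smult_distrib[of _ p q _ p]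
      mult_smult_assoc_mat[of _ p q _ p] ss cc)
  have 2: "(c \<cdot>\<^sub>m B) * mat_adjoint (c \<cdot>\<^sub>m B) = k \<cdot>\<^sub>m (B * mat_adjoint B)"
    using B by (simp add: mat_adjoint_smult mult_smult_distrib[of _ q p _ q]
      mult_smult_assoc_mat[of _ q p _ q] ss cc)
  show ?thesis unfolding unitary_map_def 1 2 k_def[symmetric] using B by auto
qed

lemma sum_diag_adjoint_mult:
  fixes B :: "complex mat"
  assumes "B \<in> carrier_mat q p" "i < p"
  shows "(mat_adjoint B * B) $$ (i, i) = (\<Sum>x<q. complex_of_real ((cmod (B $$ (x, i)))\<^sup>2))"
  using assms by (subst mat_mult_index_sum[OF mat_adjoint_carrier[OF assms(1)] assms(1)])
    (auto simp: complex_norm_square mult.commute simp del: of_real_power intro!: sum.cong)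

section \<open>Cells between powers of Hilb\<close>

text \<open>
  A 2-cell between endo-1-cells of \<open>Hilb\<close> is just a matrix, with vertical composition as
  product and horizontal composition as Kronecker product. Both composites of the theorem
  are of this kind.
\<close>
definition single_cell :: "complex mat \<Rightarrow> two_cell" where
  "single_cell A = mat 1 1 (\<lambda>_. A)"

lemma single_cell_inject [simp]: "single_cell A = single_cell B \<longleftrightarrow> A = B"
proof
  assume "single_cell A = single_cell B"
  then have "single_cell A $$ (0, 0) = single_cell B $$ (0, 0)" by simp
  then show "A = B" by (simp add: single_cell_def)
qed simp

lemma vcomp_single: "single_cell B \<cdot> single_cell A = single_cell (B * A)"
  by (rule eq_matI) (simp_all add: vcomp_def single_cell_def)

lemma hcomp_single: "single_cell A \<Zsemi>\<^sub>2 single_cell B = single_cell (kron A B)"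
  by (rule eq_matI) (simp_all add: hcomp_def single_cell_def del: diag_block_mat.simps)

lemma scale2_single: "scale2 c (single_cell A) = single_cell (c \<cdot>\<^sub>m A)"
  by (rule eq_matI) (simp_all add: scale2_def single_cell_def)

lemma dagger_single: "dagger (single_cell A) = single_cell (mat_adjoint A)"
  by (rule eq_matI) (simp_all add: dagger_def single_cell_def)

lemma id_cell_hilb: "id_cell (hilb p) = single_cell (1\<^sub>m p)"
  by (rule eq_matI) (simp_all add: id_cell_def hilb_def single_cell_def)

lemma hilb_comp: "hilb p \<Zsemi>\<^sub>1 hilb q = hilb (p * q)"
  by (rule eq_matI) (simp_all add: comp1_def hilb_def scalar_prod_def)

lemma W_L_comp_W_R: "W_L n \<Zsemi>\<^sub>1 W_R n = hilb n"
  by (rule eq_matI) (simp_all add: comp1_def hilb_def W_L_def W_R_def scalar_prod_def)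

lemma unitary_cell_hilb_iff:
  "unitary_cell M (hilb p) (hilb q) \<longleftrightarrow> (\<exists>A. M = single_cell A \<and> unitary_map A p q)"
proof
  assume U: "unitary_cell M (hilb p) (hilb q)"
  then have d: "dim_row M = 1" "dim_col M = 1" and c: "M $$ (0, 0) \<in> carrier_mat q p"
    by (simp_all add: unitary_cell_def is_two_cell_def hilb_def)
  have M: "M = single_cell (M $$ (0, 0))"
    by (rule eq_matI) (use d in \<open>simp_all add: single_cell_def\<close>)
  have "unitary_map (M $$ (0, 0)) p q"
    using U c unfolding unitary_cell_def unitary_map_def
    by (subst (asm) (2 3 4 5) M) (simp add: dagger_single vcomp_single id_cell_hilb)
  with M show "\<exists>A. M = single_cell A \<and> unitary_map A p q" by blast
next
  assume "\<exists>A. M = single_cell A \<and> unitary_map A p q"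
  then show "unitary_cell M (hilb p) (hilb q)"
    by (auto simp: unitary_cell_def unitary_map_def dagger_single vcomp_single id_cell_hilb)
      (simp add: is_two_cell_def single_cell_def hilb_def)
qed

definition tuple_cell :: "nat \<Rightarrow> (nat \<Rightarrow> complex mat) \<Rightarrow> two_cell" where
  "tuple_cell n u = mat 1 n (\<lambda>(_, i). u i)"

lemma scale2_tuple: "scale2 c (tuple_cell n u) = tuple_cell n (\<lambda>i. c \<cdot>\<^sub>m u i)"
  by (rule eq_matI) (simp_all add: scale2_def tuple_cell_def)

lemma hcomp_eq_single:
  assumes "dim_col \<alpha> = 1" "dim_row \<beta> = 1"
  shows "\<alpha> \<Zsemi>\<^sub>2 \<beta> =
    single_cell (diag_block_mat (map (\<lambda>j. kron (\<alpha> $$ (j, 0)) (\<beta> $$ (0, j))) [0..<dim_row \<alpha>]))"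
  by (rule eq_matI) (use assms in \<open>simp_all add: hcomp_def single_cell_def\<close>)

text \<open>
  Composition along \<open>Hilb\<^sup>n\<close> takes the direct sum over the classical index: a controlled operation
  becomes a block-diagonal matrix.
\<close>
lemma W_L_hcomp_tuple:
  "id_cell (W_L n) \<Zsemi>\<^sub>2 tuple_cell n u = single_cell (diag_block_mat (map u [0..<n]))"
proof -
  have d: "dim_row (id_cell (W_L n)) = n" "dim_col (id_cell (W_L n)) = 1"
    "dim_row (tuple_cell n u) = 1"
    by (simp_all add: id_cell_def W_L_def tuple_cell_def)
  have "map (\<lambda>j. kron (id_cell (W_L n) $$ (j, 0)) (tuple_cell n u $$ (0, j))) [0..<n] = map u [0..<n]"
    using kron_unit_left by (intro map_cong) (simp_all add: id_cell_def W_L_def tuple_cell_def)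
  then show ?thesis by (simp only: hcomp_eq_single[OF d(2,3)] d(1))
qed

lemma unitary_tuple_cellD:
  assumes "unitary_cell (tuple_cell n u) (W_R n \<Zsemi>\<^sub>1 hilb d) (W_R n \<Zsemi>\<^sub>1 hilb d)" "i < n"
  shows "unitary_map (u i) d d"
proof -
  have W: "(W_R n \<Zsemi>\<^sub>1 hilb d) $$ (0, i) = d" "dim_row (W_R n \<Zsemi>\<^sub>1 hilb d) = 1"
    "dim_col (W_R n \<Zsemi>\<^sub>1 hilb d) = n"
    using assms(2) by (simp_all add: comp1_def hilb_def W_R_def scalar_prod_def)
  have eq: "(dagger (tuple_cell n u) \<cdot> tuple_cell n u) $$ (0, i) = id_cell (W_R n \<Zsemi>\<^sub>1 hilb d) $$ (0, i)"
    "(tuple_cell n u \<cdot> dagger (tuple_cell n u)) $$ (0, i) = id_cell (W_R n \<Zsemi>\<^sub>1 hilb d) $$ (0, i)"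
    using assms(1) by (simp_all add: unitary_cell_def)
  have "u i \<in> carrier_mat d d"
    using assms W by (auto simp: unitary_cell_def is_two_cell_def tuple_cell_def)
  then show ?thesis
    using eq assms(2) W
    by (simp add: unitary_map_def vcomp_def dagger_def tuple_cell_def id_cell_def)
qed

definition all_ones :: "nat \<Rightarrow> nat \<Rightarrow> complex mat" where
  "all_ones p q = mat p q (\<lambda>_. 1)"

lemma Create_single: "Create n = single_cell (all_ones n 1)"
  by (simp add: Create_def single_cell_def all_ones_def)

lemma Delete_single: "Delete n = single_cell (all_ones 1 n)"
proof -
  have "mat_adjoint (all_ones n 1) = all_ones 1 n"
    by (rule eq_matI) (simp_all add: all_ones_def)
  then show ?thesis by (simp add: Delete_def Create_single dagger_single)
qed

definition cup_mat :: "nat \<Rightarrow> complex mat" where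
  "cup_mat d = mat (d * d) 1 (\<lambda>(x, _). if x div d = x mod d then 1 else 0)"

lemma cup_mat_dim [simp]: "dim_row (cup_mat d) = d * d" "dim_col (cup_mat d) = 1"
  by (simp_all add: cup_mat_def)

lemma cup_mat_index:
  "i < d \<Longrightarrow> j < d \<Longrightarrow> cup_mat d $$ (i * d + j, 0) = (if i = j then 1 else 0)"
  using block_index_less[of i d j d] by (simp add: cup_mat_def)

lemma cup_single: "cup d = single_cell (cup_mat d)"
proof -
  have "(\<Sum>j<d. kron (ket d j) (ket d j) $$ (x, y)) = cup_mat d $$ (x, y)"
    if xy: "x < d * d" "y < 1" for x y
  proof -
    from xy(1) obtain i r where ir: "i < d" "r < d" "x = i * d + r" by (rule less_mult_blockE)
    have "kron (ket d j) (ket d j) $$ (x, y) = (if i = j then if r = j then 1 else 0 else 0)" for j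
      using ir xy kron_index[of "ket d j" d 1 "ket d j" d 1 i r 0 0] by (simp add: ket_def)
    then show ?thesis using ir xy by (simp add: cup_mat_index cong: if_cong)
  qed
  then have "mat (d * d) 1 (\<lambda>rc. \<Sum>j<d. kron (ket d j) (ket d j) $$ rc) = cup_mat d"
    by (intro eq_matI) (auto simp: cup_mat_def)
  then show ?thesis by (simp add: cup_def single_cell_def)
qed

lemma bell_single: "bell d = single_cell (complex_of_real (1 / sqrt (real d)) \<cdot>\<^sub>m cup_mat d)"
  by (simp add: bell_def cup_single scale2_single)

section \<open>Teleportation and bending composites in coordinates\<close>

lemma diag_block_tuple_index:
  assumes "\<And>i. i < n \<Longrightarrow> u i \<in> carrier_mat d d" "i < n" "j < n" "r < d" "s < d"
  shows "diag_block_mat (map u [0..<n]) $$ (i * d + r, j * d + s) = (if i = j then u i $$ (r, s) else 0)"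
  using diag_block_mat_index[of "map u [0..<n]" d d i j r s] assms by simp

text \<open>
  The Bell state identifies the second measured system with the output wire: in the measured pair \<open>(a,s)\<close>,
  the index \<open>s\<close> becomes an output index while \<open>a\<close> remains the input.
\<close>
lemma measure_bell_index:
  assumes m: "m \<in> carrier_mat n (d * d)" and "i < n" "s < d" "a < d"
  shows "(kron m (1\<^sub>m d) * kron (1\<^sub>m d) (c \<cdot>\<^sub>m cup_mat d)) $$ (i * d + s, a) = c * m $$ (i, a * d + s)"
    (is "(?K * ?C) $$ _ = _")
proof -
  have cup: "c \<cdot>\<^sub>m cup_mat d \<in> carrier_mat (d * d) 1" by (simp add: cup_mat_def)
  have K: "?K \<in> carrier_mat (n * d) (d * (d * d))" and C: "?C \<in> carrier_mat (d * (d * d)) d"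
    using kron_carrier[OF m one_carrier_mat[of d]] kron_carrier[OF one_carrier_mat[of d] cup]
    by (simp_all add: mult.assoc)
  have Ki: "?K $$ (i * d + s, b * (d * d) + (j * d + t)) = (if s = t then m $$ (i, b * d + j) else 0)"
    if "b < d" "j < d" "t < d" for b j t
  proof -
    \<comment> \<open>The Kronecker product is strictly associative: both bracketings number the triple alike.\<close>
    have idx: "b * (d * d) + (j * d + t) = (b * d + j) * d + t" by (simp add: algebra_simps)
    show ?thesis
      unfolding idx
      using kron_index[OF m one_carrier_mat[of d] assms(2,3) block_index_less[OF that(1,2)] that(3)]
        assms(3) that(3) by simp
  qed
  have Ci: "?C $$ (b * (d * d) + (j * d + t), a) = (if a = b then if j = t then c else 0 else 0)"
    if "b < d" "j < d" "t < d" for b j t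
    using kron_index[OF one_carrier_mat[of d] cup that(1) block_index_less[OF that(2,3)] assms(4), of 0]
      that assms(4) cup_mat_index[OF that(2,3)] block_index_less[OF that(2,3)] cup by auto
  have "(?K * ?C) $$ (i * d + s, a) = (\<Sum>x<d * (d * d). ?K $$ (i * d + s, x) * ?C $$ (x, a))"
    by (rule mat_mult_index_sum[OF K C block_index_less[OF assms(2,3)] assms(4)])
  also have "\<dots> = (\<Sum>b<d. \<Sum>j<d. \<Sum>t<d. if a = b then if s = j then if j = t
      then c * m $$ (i, b * d + j) else 0 else 0 else 0)"
    unfolding sum_block by (intro sum.cong refl) (simp add: Ki Ci)
  also have "\<dots> = c * m $$ (i, a * d + s)"
    using assms by (simp add: sum_if_const sum.delta cong: if_cong)
  finally show ?thesis .
qed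

lemma teleportation_composite_index:
  assumes u: "\<And>i. i < n \<Longrightarrow> u i \<in> carrier_mat d d" and m: "m \<in> carrier_mat n (d * d)"
    and "i < n" "r < d" "a < d"
  shows "(diag_block_mat (map u [0..<n]) * kron m (1\<^sub>m d) * kron (1\<^sub>m d) (c \<cdot>\<^sub>m cup_mat d)) $$ (i * d + r, a) =
    c * (u i * mat d d (\<lambda>(s, b). m $$ (i, b * d + s))) $$ (r, a)"
    (is "(?D * ?K * ?C) $$ _ = _")
proof -
  have D: "?D \<in> carrier_mat (n * d) (n * d)"
    using diag_block_mat_carrier[of "map u [0..<n]" d d] u by simp
  have cup: "c \<cdot>\<^sub>m cup_mat d \<in> carrier_mat (d * d) 1" by (simp add: cup_mat_def)
  have K: "?K \<in> carrier_mat (n * d) (d * (d * d))" and C: "?C \<in> carrier_mat (d * (d * d)) d"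
    using kron_carrier[OF m one_carrier_mat[of d]] kron_carrier[OF one_carrier_mat[of d] cup]
    by (simp_all add: mult.assoc)
  have "(?D * ?K * ?C) $$ (i * d + r, a) = (?D * (?K * ?C)) $$ (i * d + r, a)"
    by (simp only: assoc_mult_mat[OF D K C])
  also have "\<dots> = (\<Sum>x<n * d. ?D $$ (i * d + r, x) * (?K * ?C) $$ (x, a))"
    by (rule mat_mult_index_sum[OF D mult_carrier_mat[OF K C] block_index_less[OF assms(3,4)] assms(5)])
  also have "\<dots> = (\<Sum>j<n. if i = j then \<Sum>s<d. u i $$ (r, s) * (c * m $$ (i, a * d + s)) else 0)"
    unfolding sum_block using assms
    by (intro sum.cong refl) (auto simp: diag_block_tuple_index[OF u] measure_bell_index[OF m] simp del: index_mult_mat)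
  also have "\<dots> = c * (u i * mat d d (\<lambda>(s, b). m $$ (i, b * d + s))) $$ (r, a)"
    using assms(3-5) by (subst mat_mult_index_sum[OF u[OF assms(3)] mat_carrier assms(4,5)])
      (simp add: sum.delta sum_distrib_left algebra_simps)
  finally show ?thesis .
qed

definition bend_mat :: "nat \<Rightarrow> nat \<Rightarrow> (nat \<Rightarrow> complex mat) \<Rightarrow> complex mat" where
  "bend_mat d n u = mat (d * d) n (\<lambda>(x, i). u i $$ (x div d, x mod d))"

lemma bend_mat_carrier [simp]: "bend_mat d n u \<in> carrier_mat (d * d) n"
  by (simp add: bend_mat_def)

lemma bend_mat_dim [simp]: "dim_row (bend_mat d n u) = d * d" "dim_col (bend_mat d n u) = n"
  by (simp_all add: bend_mat_def)

lemma bend_mat_index: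
  "r < d \<Longrightarrow> s < d \<Longrightarrow> i < n \<Longrightarrow> bend_mat d n u $$ (r * d + s, i) = u i $$ (r, s)"
  using block_index_less[of r d s d] by (simp add: bend_mat_def)

text \<open>
  The bent cell is evaluated from right to left on the basis vector \<open>i\<close>. The cup creates the pairs \<open>(s,s)\<close>,
  summed over \<open>s\<close>; the controlled operation maps \<open>(i,s,s)\<close> to the sum over \<open>r\<close> of the \<open>(i,r,s)\<close>
  with weights \<open>u i $$ (r,s)\<close>; and \<open>Delete\<close> forgets \<open>i\<close>.
\<close>
lemma bend_tuple:
  assumes u: "\<And>i. i < n \<Longrightarrow> u i \<in> carrier_mat d d"
  shows "bend d n (tuple_cell n u) = single_cell (bend_mat d n u)"
proof -
  let ?D = "diag_block_mat (map u [0..<n])"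
  let ?J = "kron (all_ones 1 n) (1\<^sub>m (d * d))"
  let ?V = "kron ?D (1\<^sub>m d)"
  let ?C = "kron (1\<^sub>m n) (cup_mat d)"
  have D: "?D \<in> carrier_mat (n * d) (n * d)"
    using diag_block_mat_carrier[of "map u [0..<n]" d d] u by simp
  have ones: "all_ones 1 n \<in> carrier_mat 1 n" by (simp add: all_ones_def)
  have cup: "cup_mat d \<in> carrier_mat (d * d) 1" by (simp add: cup_mat_def)
  have J: "?J \<in> carrier_mat (d * d) (n * (d * d))"
    using kron_carrier[OF ones one_carrier_mat[of "d * d"]] by simp
  have V: "?V \<in> carrier_mat (n * (d * d)) (n * (d * d))"
    using kron_carrier[OF D one_carrier_mat[of d]] by (simp add: mult.assoc)
  have C: "?C \<in> carrier_mat (n * (d * d)) n"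
    using kron_carrier[OF one_carrier_mat[of n] cup] by simp
  have Ji: "?J $$ (r * d + s, j * (d * d) + (p * d + q)) = (if r = p then if s = q then 1 else 0 else 0)"
    if "r < d" "s < d" "j < n" "p < d" "q < d" for r s j p q
  proof -
    have "r = p \<and> s = q" if "r * d + s = p * d + q"
    proof -
      have "(r * d + s) div d = (p * d + q) div d" "(r * d + s) mod d = (p * d + q) mod d"
        using that by simp_all
      then show ?thesis using \<open>s < d\<close> \<open>q < d\<close> by simp
    qed
    then show ?thesis
      using kron_index[OF ones one_carrier_mat[of "d * d"] _ block_index_less[OF that(1,2)] that(3)
          block_index_less[OF that(4,5)], of 0] that block_index_less[OF that(1,2)]
        block_index_less[OF that(4,5)] by (auto simp: all_ones_def)
  qed
  have Vi: "?V $$ (j * (d * d) + (p * d + q), i * (d * d) + (r * d + s)) =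
      (if j = i then if q = s then u j $$ (p, r) else 0 else 0)"
    if "j < n" "p < d" "q < d" "i < n" "r < d" "s < d" for i j p q r s
  proof -
    have idx: "j * (d * d) + (p * d + q) = (j * d + p) * d + q"
      "i * (d * d) + (r * d + s) = (i * d + r) * d + s" by (simp_all add: algebra_simps)
    show ?thesis
      unfolding idx
      using kron_index[OF D one_carrier_mat[of d] block_index_less[OF that(1,2)] that(3)
          block_index_less[OF that(4,5)] that(6)] that
      by (simp add: diag_block_tuple_index[OF u])
  qed
  have Ci: "?C $$ (j * (d * d) + (p * d + q), i) = (if i = j then if p = q then 1 else 0 else 0)"
    if "j < n" "p < d" "q < d" "i < n" for i j p q
    using kron_index[OF one_carrier_mat[of n] cup that(1) block_index_less[OF that(2,3)] that(4), of 0]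
      that cup_mat_index[OF that(2,3)] by auto
  have VC: "(?V * ?C) $$ (j * (d * d) + (p * d + q), i) = (if i = j then u j $$ (p, q) else 0)"
    if "j < n" "p < d" "q < d" "i < n" for i j p q
  proof -
    have "(?V * ?C) $$ (j * (d * d) + (p * d + q), i) =
        (\<Sum>x<n * (d * d). ?V $$ (j * (d * d) + (p * d + q), x) * ?C $$ (x, i))"
      using that by (intro mat_mult_index_sum[OF V C] block_index_less)
    also have "\<dots> = (\<Sum>k<n. \<Sum>r<d. \<Sum>s<d. if i = k then if q = r then if r = s
        then if i = j then u j $$ (p, r) else 0 else 0 else 0 else 0)"
      unfolding sum_block using that by (intro sum.cong refl) (simp add: Vi Ci)
    finally show ?thesis using that by (simp add: sum_if_const sum.delta cong: if_cong)
  qed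
  have JVC: "?J * (?V * ?C) = bend_mat d n u"
  proof (subst mat_eq_block_iff[of _ d d n], intro mult_carrier_mat[OF J mult_carrier_mat[OF V C]],
      rule bend_mat_carrier, intro allI impI)
    fix r s i assume rsi: "r < d" "s < d" "i < n"
    have "(?J * (?V * ?C)) $$ (r * d + s, i) =
        (\<Sum>x<n * (d * d). ?J $$ (r * d + s, x) * (?V * ?C) $$ (x, i))"
      using rsi by (intro mat_mult_index_sum[OF J mult_carrier_mat[OF V C]] block_index_less)
    also have "\<dots> = (\<Sum>j<n. \<Sum>p<d. \<Sum>q<d. if i = j then if r = p then if s = q
        then u i $$ (p, q) else 0 else 0 else 0)"
      unfolding sum_block using rsi by (intro sum.cong refl) (simp add: Ji VC del: index_mult_mat One_nat_def)
    finally show "(?J * (?V * ?C)) $$ (r * d + s, i) = bend_mat d n u $$ (r * d + s, i)"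
      using rsi by (simp add: sum_if_const sum.delta bend_mat_index cong: if_cong)
  qed
  have "bend d n (tuple_cell n u) = single_cell (?J * ?V * ?C)"
    by (simp add: bend_def Delete_single hilb_comp W_L_comp_W_R id_cell_hilb W_L_hcomp_tuple
        cup_single hcomp_single vcomp_single)
  then show ?thesis by (simp only: assoc_mult_mat[OF J V C] JVC)
qed

section \<open>Teleportation and horizontal unitarity\<close>

lemma bend_mat_smult:
  assumes "\<And>i. i < n \<Longrightarrow> u i \<in> carrier_mat d d"
  shows "bend_mat d n (\<lambda>i. c \<cdot>\<^sub>m u i) = c \<cdot>\<^sub>m bend_mat d n u"
proof (rule eq_matI)
  fix x i assume "x < dim_row (c \<cdot>\<^sub>m bend_mat d n u)" "i < dim_col (c \<cdot>\<^sub>m bend_mat d n u)"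
  then have x: "x < d * d" and i: "i < n" by (simp_all add: bend_mat_def)
  have "d > 0" using x by (cases d) simp_all
  then have "x div d < d" "x mod d < d" using x by (simp_all add: less_mult_imp_div_less)
  then show "bend_mat d n (\<lambda>i. c \<cdot>\<^sub>m u i) $$ (x, i) = (c \<cdot>\<^sub>m bend_mat d n u) $$ (x, i)"
    using x i assms[OF i] by (simp add: bend_mat_def)
qed (simp_all add: bend_mat_def)

lemma horizontally_unitary_up_to_scalar_iff:
  assumes "\<And>i. i < n \<Longrightarrow> u i \<in> carrier_mat d d"
  shows "horizontally_unitary_up_to_scalar d n (tuple_cell n u) \<longleftrightarrow>
    (\<exists>c. c \<noteq> 0 \<and> unitary_map (c \<cdot>\<^sub>m bend_mat d n u) n (d * d))"
  using assms
  by (simp add: horizontally_unitary_up_to_scalar_def horizontally_unitary_def scale2_tuple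
      bend_tuple bend_mat_smult W_L_comp_W_R hilb_comp unitary_cell_hilb_iff)

text \<open>
  Block \<open>i\<close> of the teleportation equation has this form, with \<open>V\<close> the correction \<open>u i\<close>: the
  correction determines the measurement.
\<close>
lemma unitary_map_left_cancel:
  assumes V: "unitary_map V d d" and N: "N \<in> carrier_mat d d"
  shows "V * N = t \<cdot>\<^sub>m 1\<^sub>m d \<longleftrightarrow> N = t \<cdot>\<^sub>m mat_adjoint V"
proof
  have c: "V \<in> carrier_mat d d" "mat_adjoint V \<in> carrier_mat d d"
    and u: "mat_adjoint V * V = 1\<^sub>m d" "V * mat_adjoint V = 1\<^sub>m d"
    using V by (auto simp: unitary_map_def mat_adjoint_carrier)
  { assume "V * N = t \<cdot>\<^sub>m 1\<^sub>m d"
    then have "mat_adjoint V * (V * N) = t \<cdot>\<^sub>m mat_adjoint V"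
      using c by (simp add: mult_smult_distrib[OF c(2) one_carrier_mat])
    then show "N = t \<cdot>\<^sub>m mat_adjoint V"
      using u(1) N by (simp flip: assoc_mult_mat[OF c(2,1) N]) }
  { assume "N = t \<cdot>\<^sub>m mat_adjoint V"
    then show "V * N = t \<cdot>\<^sub>m 1\<^sub>m d" using u(2) by (simp add: mult_smult_distrib[OF c]) }
qed

text \<open>
  The factor \<open>\<surd>d / \<surd>n\<close> is the quotient of the normalizations \<open>1/\<surd>n\<close> of the right-hand side and
  \<open>1/\<surd>d\<close> of the Bell state. Row \<open>i\<close> of the measurement is the inverse of the correction \<open>u i\<close> up to
  this factor, with entry \<open>(s,a)\<close> of the inverse at column \<open>(a,s)\<close>; since the inverse of \<open>u i\<close> is its
  adjoint, these rows together form the adjoint of the bent matrix.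
\<close>
lemma teleportation_equation_iff:
  assumes u: "\<And>i. i < n \<Longrightarrow> unitary_map (u i) d d" and d: "d > 0" and m: "m \<in> carrier_mat n (d * d)"
  shows "(id_cell (W_L n) \<Zsemi>\<^sub>2 tuple_cell n u) \<cdot> (single_cell m \<Zsemi>\<^sub>2 id_cell (hilb d))
        \<cdot> (id_cell (hilb d) \<Zsemi>\<^sub>2 bell d)
      = scale2 (complex_of_real (1 / sqrt (real n))) (Create n \<Zsemi>\<^sub>2 id_cell (hilb d))
    \<longleftrightarrow> m = complex_of_real (sqrt (real d) / sqrt (real n)) \<cdot>\<^sub>m mat_adjoint (bend_mat d n u)"
proof -
  let ?D = "diag_block_mat (map u [0..<n])"
  let ?c = "complex_of_real (1 / sqrt (real d))"
  let ?k = "complex_of_real (1 / sqrt (real n))"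
  let ?t = "complex_of_real (sqrt (real d) / sqrt (real n))"
  let ?L = "?D * kron m (1\<^sub>m d) * kron (1\<^sub>m d) (?c \<cdot>\<^sub>m cup_mat d)"
  let ?R = "?k \<cdot>\<^sub>m kron (all_ones n 1) (1\<^sub>m d)"
  let ?N = "\<lambda>i. mat d d (\<lambda>(s, b). m $$ (i, b * d + s))"
  have uc: "u i \<in> carrier_mat d d" if "i < n" for i using u[OF that] by (simp add: unitary_map_def)
  have D: "?D \<in> carrier_mat (n * d) (n * d)"
    using diag_block_mat_carrier[of "map u [0..<n]" d d] uc by simp
  have ones: "all_ones n 1 \<in> carrier_mat n 1" by (simp add: all_ones_def)
  have LR: "?L \<in> carrier_mat (n * d) d" "?R \<in> carrier_mat (n * d) d"
    using D by (auto simp: cup_mat_def all_ones_def intro!: carrier_matI)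
  have Ri: "?R $$ (i * d + r, a) = (if r = a then ?k else 0)" if "i < n" "r < d" "a < d" for i r a
    using kron_index[OF ones one_carrier_mat[of d] that(1,2) _ that(3), of 0] that
      block_index_less[OF that(1,2)] by (auto simp: all_ones_def)
  have ct: "?c * x = ?k \<longleftrightarrow> x = ?t" for x
    using d by (simp add: field_simps)
  have c0: "?c \<noteq> 0" using d by simp
  \<comment> \<open>The two normalizations combine into the single factor \<open>?t\<close>; for \<open>n = 0\<close> there are no blocks
     and \<open>?k = ?t = 0\<close>, since division by zero is zero.\<close>
  have "?L = ?R \<longleftrightarrow> (\<forall>i<n. \<forall>r<d. \<forall>a<d. ?c * (u i * ?N i) $$ (r, a) = (if r = a then ?k else 0))"
    unfolding mat_eq_block_iff[OF LR]
    using Ri teleportation_composite_index[OF uc m, where c = ?c] by (auto simp del: index_mult_mat)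
  also have "\<dots> \<longleftrightarrow> (\<forall>i<n. \<forall>r<d. \<forall>a<d. (u i * ?N i) $$ (r, a) = (if r = a then ?t else 0))"
    using ct c0 by (auto simp del: index_mult_mat)
  also have "\<dots> \<longleftrightarrow> (\<forall>i<n. u i * ?N i = ?t \<cdot>\<^sub>m 1\<^sub>m d)"
  proof (intro all_cong1 imp_cong refl)
    fix i assume "i < n"
    then have uN: "u i * ?N i \<in> carrier_mat d d" using uc by (intro mult_carrier_mat) auto
    show "(\<forall>r<d. \<forall>a<d. (u i * ?N i) $$ (r, a) = (if r = a then ?t else 0)) \<longleftrightarrow> u i * ?N i = ?t \<cdot>\<^sub>m 1\<^sub>m d"
      using uN by (auto simp del: index_mult_mat simp: mat_eq_iff)
  qed
  also have "\<dots> \<longleftrightarrow> (\<forall>i<n. ?N i = ?t \<cdot>\<^sub>m mat_adjoint (u i))"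
    using unitary_map_left_cancel[OF u] by auto
  also have "\<dots> \<longleftrightarrow> (\<forall>i<n. \<forall>a<d. \<forall>s<d. m $$ (i, a * d + s) = ?t * cnj (u i $$ (a, s)))"
  proof (intro all_cong1 imp_cong refl)
    fix i assume "i < n"
    then have "dim_row (u i) = d" "dim_col (u i) = d" using uc by auto
    then show "?N i = ?t \<cdot>\<^sub>m mat_adjoint (u i) \<longleftrightarrow> (\<forall>a<d. \<forall>s<d. m $$ (i, a * d + s) = ?t * cnj (u i $$ (a, s)))"
      by (auto simp: mat_eq_iff)
  qed
  also have "\<dots> \<longleftrightarrow> m = ?t \<cdot>\<^sub>m mat_adjoint (bend_mat d n u)"
  proof -
    have B: "(?t \<cdot>\<^sub>m mat_adjoint (bend_mat d n u)) $$ (i, a * d + s) = ?t * cnj (u i $$ (a, s))"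
      if "i < n" "a < d" "s < d" for i a s
      using that block_index_less[OF that(2,3)] by (simp add: bend_mat_index)
    have Bc: "?t \<cdot>\<^sub>m mat_adjoint (bend_mat d n u) \<in> carrier_mat n (d * d)"
      using mat_adjoint_carrier[OF bend_mat_carrier] by auto
    show ?thesis
    proof
      assume A: "\<forall>i<n. \<forall>a<d. \<forall>s<d. m $$ (i, a * d + s) = ?t * cnj (u i $$ (a, s))"
      show "m = ?t \<cdot>\<^sub>m mat_adjoint (bend_mat d n u)"
      proof (rule eq_matI)
        fix i x assume "i < dim_row (?t \<cdot>\<^sub>m mat_adjoint (bend_mat d n u))"
          "x < dim_col (?t \<cdot>\<^sub>m mat_adjoint (bend_mat d n u))"
        then have i: "i < n" and x: "x < d * d" using Bc by auto
        from x obtain a s where "a < d" "s < d" "x = a * d + s" by (rule less_mult_blockE)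
        with A B i show "m $$ (i, x) = (?t \<cdot>\<^sub>m mat_adjoint (bend_mat d n u)) $$ (i, x)" by metis
      qed (use m Bc in auto)
    qed (use B in auto)
  qed
  finally show ?thesis
    by (simp add: W_L_hcomp_tuple id_cell_hilb hcomp_single bell_single vcomp_single Create_single
        scale2_single)
qed

lemma teleportation_solution_iff:
  assumes "\<And>i. i < n \<Longrightarrow> unitary_map (u i) d d" "d > 0"
  shows "teleportation_solution d n (tuple_cell n u) \<longleftrightarrow>
    unitary_map (complex_of_real (sqrt (real d) / sqrt (real n)) \<cdot>\<^sub>m bend_mat d n u) n (d * d)"
    (is "_ \<longleftrightarrow> unitary_map (?t \<cdot>\<^sub>m ?B) _ _")
proof -
  have adj: "mat_adjoint (?t \<cdot>\<^sub>m ?B) = ?t \<cdot>\<^sub>m mat_adjoint ?B"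
    by (simp add: mat_adjoint_smult)
  have "teleportation_solution d n (tuple_cell n u) \<longleftrightarrow> unitary_map (?t \<cdot>\<^sub>m mat_adjoint ?B) (d * d) n"
    unfolding teleportation_solution_def hilb_comp W_L_comp_W_R unitary_cell_hilb_iff
    using teleportation_equation_iff[OF assms] by (auto simp: unitary_map_def)
  also have "\<dots> \<longleftrightarrow> unitary_map (?t \<cdot>\<^sub>m ?B) n (d * d)"
    using unitary_map_adjoint adj mat_adjoint_adjoint by metis
  finally show ?thesis .
qed

text \<open>
  Every column of each \<open>u i\<close> is a unit vector, so each of the \<open>n\<close> columns of the bent matrix has
  squared norm \<open>d\<close>.
\<close>
lemma frobenius_bend_mat:
  assumes u: "\<And>i. i < n \<Longrightarrow> unitary_map (u i) d d"
  shows "(\<Sum>i<n. \<Sum>x<d * d. (cmod (bend_mat d n u $$ (x, i)))\<^sup>2) = real n * real d"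
proof -
  have "(\<Sum>x<d * d. (cmod (bend_mat d n u $$ (x, i)))\<^sup>2) = real d" if i: "i < n" for i
  proof -
    have uc: "u i \<in> carrier_mat d d" and uu: "mat_adjoint (u i) * u i = 1\<^sub>m d"
      using u[OF i] by (auto simp: unitary_map_def)
    have col: "(\<Sum>r<d. (cmod (u i $$ (r, s)))\<^sup>2) = 1" if "s < d" for s
    proof -
      have "complex_of_real (\<Sum>r<d. (cmod (u i $$ (r, s)))\<^sup>2) = 1"
        using sum_diag_adjoint_mult[OF uc that] uu that by simp
      then show ?thesis using of_real_eq_1_iff by blast
    qed
    have "(\<Sum>x<d * d. (cmod (bend_mat d n u $$ (x, i)))\<^sup>2) = (\<Sum>r<d. \<Sum>s<d. (cmod (u i $$ (r, s)))\<^sup>2)"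
      unfolding sum_block using i by (intro sum.cong refl) (simp add: bend_mat_index)
    also have "\<dots> = (\<Sum>s<d. \<Sum>r<d. (cmod (u i $$ (r, s)))\<^sup>2)" by (rule sum.swap)
    finally show ?thesis using col by simp
  qed
  then show ?thesis by simp
qed

text \<open>
  The columns of a unitary map are unit vectors, and so are its rows; adding up all squared
  entries in either order counts columns and rows.
\<close>
lemma unitary_map_frobenius:
  assumes "unitary_map X p q"
  shows "(\<Sum>i<p. \<Sum>x<q. (cmod (X $$ (x, i)))\<^sup>2) = real p" and "p = q"
proof -
  have *: "(\<Sum>i<p. \<Sum>x<q. (cmod (X $$ (x, i)))\<^sup>2) = real p" if "unitary_map X p q" for X p q
  proof -
    have X: "X \<in> carrier_mat q p" and XX: "mat_adjoint X * X = 1\<^sub>m p"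
      using that by (auto simp: unitary_map_def)
    have "(\<Sum>x<q. (cmod (X $$ (x, i)))\<^sup>2) = 1" if "i < p" for i
    proof -
      have "complex_of_real (\<Sum>x<q. (cmod (X $$ (x, i)))\<^sup>2) = 1"
        using sum_diag_adjoint_mult[OF X that] XX that by simp
      then show ?thesis using of_real_eq_1_iff by blast
    qed
    then show ?thesis by simp
  qed
  show 1: "(\<Sum>i<p. \<Sum>x<q. (cmod (X $$ (x, i)))\<^sup>2) = real p" using *[OF assms] .
  have "X \<in> carrier_mat q p" using assms by (simp add: unitary_map_def)
  then have "(\<Sum>x<q. \<Sum>i<p. (cmod (X $$ (x, i)))\<^sup>2) = real q"
    using *[OF unitary_map_adjoint[OF assms]] by simp
  with 1 show "p = q" using sum.swap[of "\<lambda>i x. (cmod (X $$ (x, i)))\<^sup>2" "{..<q}" "{..<p}"] by simp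
qed

text \<open>
  Comparing the squared entries of \<open>c B\<close>, which sum to \<open>n\<close>, with those of \<open>B\<close> gives \<open>\<bar>c\<bar>\<^sup>2 d = 1\<close>;
  the form \<open>d/n\<close> uses \<open>n = d\<^sup>2\<close>.
\<close>
lemma bend_mat_scalar:
  assumes u: "\<And>i. i < n \<Longrightarrow> unitary_map (u i) d d" and d: "d > 0"
    and c: "unitary_map (c \<cdot>\<^sub>m bend_mat d n u) n (d * d)"
  shows "(cmod c)\<^sup>2 = real d / real n"
proof -
  let ?B = "bend_mat d n u"
  have nd: "n = d * d" using unitary_map_frobenius(2)[OF c] .
  have "real n = (\<Sum>i<n. \<Sum>x<d * d. (cmod ((c \<cdot>\<^sub>m ?B) $$ (x, i)))\<^sup>2)"
    using unitary_map_frobenius(1)[OF c] by simp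
  also have "\<dots> = (\<Sum>i<n. \<Sum>x<d * d. (cmod c)\<^sup>2 * (cmod (?B $$ (x, i)))\<^sup>2)"
    by (intro sum.cong refl) (simp add: norm_mult power_mult_distrib)
  also have "\<dots> = (cmod c)\<^sup>2 * (real n * real d)"
    using frobenius_bend_mat[OF u] by (simp flip: sum_distrib_left)
  finally show ?thesis using d nd by (simp add: field_simps)
qed

lemma teleportation_iff_horizontally_unitary:
  assumes u: "\<And>i. i < n \<Longrightarrow> unitary_map (u i) d d" and d: "d > 0"
  shows "teleportation_solution d n (tuple_cell n u) \<longleftrightarrow>
    horizontally_unitary_up_to_scalar d n (tuple_cell n u)"
proof -
  let ?B = "bend_mat d n u"
  let ?t = "complex_of_real (sqrt (real d) / sqrt (real n))"
  have uc: "u i \<in> carrier_mat d d" if "i < n" for i using u[OF that] by (simp add: unitary_map_def)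
  have "unitary_map (?t \<cdot>\<^sub>m ?B) n (d * d) \<longleftrightarrow> (\<exists>c. c \<noteq> 0 \<and> unitary_map (c \<cdot>\<^sub>m ?B) n (d * d))"
  proof
    assume T: "unitary_map (?t \<cdot>\<^sub>m ?B) n (d * d)"
    \<comment> \<open>Unitarity excludes \<open>n = 0\<close>, where the factor would vanish.\<close>
    then have "n = d * d" by (rule unitary_map_frobenius(2))
    then have "?t \<noteq> 0" using d by simp
    with T show "\<exists>c. c \<noteq> 0 \<and> unitary_map (c \<cdot>\<^sub>m ?B) n (d * d)" by blast
  next
    assume "\<exists>c. c \<noteq> 0 \<and> unitary_map (c \<cdot>\<^sub>m ?B) n (d * d)"
    then obtain c where c: "unitary_map (c \<cdot>\<^sub>m ?B) n (d * d)" by blast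
    have "(cmod c)\<^sup>2 = (cmod ?t)\<^sup>2"
      using bend_mat_scalar[OF u d c] by (simp add: norm_divide power_divide)
    with c show "unitary_map (?t \<cdot>\<^sub>m ?B) n (d * d)"
      by (simp only: unitary_map_smult_iff[OF bend_mat_carrier])
  qed
  then show ?thesis
    by (simp only: teleportation_solution_iff[OF u d] horizontally_unitary_up_to_scalar_iff[OF uc])
qed

theorem theorem4p2:
  fixes scale :: "complex \<Rightarrow> 'h::ab_group_add \<Rightarrow> 'h"
    and ip :: "'h \<Rightarrow> 'h \<Rightarrow> complex"
    and e :: "nat \<Rightarrow> 'h"
    and d n :: nat
    and U :: "nat \<Rightarrow> 'h \<Rightarrow> 'h"
  assumes "fd_hilbert scale ip"
    and "\<exists>x::'h. x \<noteq> 0"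
    and "fd_hilbert.orthonormal_basis scale ip e d"
    and "\<And>i. i < n \<Longrightarrow> Vector_Spaces.linear scale scale (U i)"
    and "unitary_cell (controlled ip e d n U) (W_R n \<Zsemi>\<^sub>1 hilb d) (W_R n \<Zsemi>\<^sub>1 hilb d)"
  shows "teleportation_solution d n (controlled ip e d n U) \<longleftrightarrow>
         horizontally_unitary_up_to_scalar d n (controlled ip e d n U)"
proof -
  interpret fd_hilbert scale ip by fact
  have span: "span (e ` {..<d}) = UNIV"
    using assms(3) by (simp add: orthonormal_basis_def)
  \<comment> \<open>An empty orthonormal basis would span only the zero vector.\<close>
  have "d \<noteq> 0"
  proof
    assume "d = 0"
    then have "(UNIV :: 'h set) = {0}" using span by simp
    then show False using assms(2) by (metis UNIV_I singletonD)
  qed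
  let ?u = "\<lambda>i. mat d d (\<lambda>(r, c). ip (e r) (U i (e c)))"
  have ctl: "controlled ip e d n U = tuple_cell n ?u"
    by (simp add: controlled_def tuple_cell_def)
  have "unitary_map (?u i) d d" if "i < n" for i
    using unitary_tuple_cellD[OF assms(5)[unfolded ctl] that] .
  then show ?thesis
    unfolding ctl using \<open>d \<noteq> 0\<close> by (intro teleportation_iff_horizontally_unitary) auto
qed

end
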